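(* Let $V$ be a Euclidean Jordan algebra, and suppose that the set $\Omega\subseteq V$ and the function $F:V\to\mathbb{R}$ are weakly spectral. Let $\Theta:V\to\mathbb{R}$ be Fréchet differentiable. If $a\in\Omega$ is a local minimizer of the problem $$\min_{x\in\Omega}\ \Theta(x)+F(x),$$ then $a$ and $\Theta'(a)$ operator commute in $V$.
   Context: A Euclidean Jordan algebra is a finite-dimensional real inner product space $(V,\langle\cdot,\cdot\rangle)$ with a bilinear commutative product $\circ$ having a unit element $e$, such that $x\circ(x^2\circ y)=x^2\circ(x\circ y)$ (where $x^2=x\circ x$) and $\langle x\circ y,z\rangle=\langle y,x\circ z\rangle$ for all $x,y,z\in V$. An automorphism of $V$ is an invertible linear map $A:V\to V$ with $A(x\circ y)=Ax\circ Ay$ for all $x,y\in V$; $\operatorname{Aut}(V)$ is the set of all automorphisms. A set $E\subseteq V$ is weakly spectral if $A(E)\subseteq E$ for all $A\in\operatorname{Aut}(V)$. A function $F:V\to\mathbb{R}$ is weakly spectral if $F(Ax)=F(x)$ for all $x\in V$ and $A\in\operatorname{Aut}(V)$. For $a\in V$, $L_a:V\to V$ is the linear map $L_a(x)=a\circ x$. Elements $a,b\in V$ operator commute if $L_aL_b=L_bL_a$. The Fréchet derivative $\Theta'(a)$ is regarded as the element of $V$ representing it through the inner product: the derivative of $\Theta$ at $a$ in direction $h$ is $\langle\Theta'(a),h\rangle$. A local minimizer is a point $a\in\Omega$ for which there is an open ball $N_a$ around $a$ such that $\Theta(a)+F(a)\le\Theta(x)+F(x)$ for all $x\in N_a\cap\Omega$.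 *)

theory Defs
  imports "HOL-Analysis.Analysis"
begin

(* The carrier is a whole type of class real_inner with an explicit finiteness assumption,
   rather than one of class euclidean_space, because the latter excludes the zero space. *)
locale euclidean_jordan_algebra =
  fixes jprod :: "'a::real_inner \<Rightarrow> 'a \<Rightarrow> 'a"  (infixl "\<odot>" 70)
    and e :: 'a
  assumes finite_dim: "\<exists>B::'a set. finite B \<and> span B = UNIV"
    and bilinear: "bilinear (\<odot>)"
    and commute: "x \<odot> y = y \<odot> x"
    and unit: "e \<odot> x = x"
    and jordan_identity: "x \<odot> ((x \<odot> x) \<odot> y) = (x \<odot> x) \<odot> (x \<odot> y)"
    and inner_assoc: "inner (x \<odot> y) z = inner y (x \<odot> z)"

definition jordan_Aut :: "('a::real_vector \<Rightarrow> 'a \<Rightarrow> 'a) \<Rightarrow> ('a \<Rightarrow> 'a) set" where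
  "jordan_Aut p = {A. linear A \<and> bij A \<and> (\<forall>x y. A (p x y) = p (A x) (A y))}"

definition weakly_spectral_set :: "('a::real_vector \<Rightarrow> 'a \<Rightarrow> 'a) \<Rightarrow> 'a set \<Rightarrow> bool" where
  "weakly_spectral_set p E \<longleftrightarrow> (\<forall>A\<in>jordan_Aut p. A ` E \<subseteq> E)"

definition weakly_spectral_fun :: "('a::real_vector \<Rightarrow> 'a \<Rightarrow> 'a) \<Rightarrow> ('a \<Rightarrow> real) \<Rightarrow> bool" where
  "weakly_spectral_fun p F \<longleftrightarrow> (\<forall>x. \<forall>A\<in>jordan_Aut p. F (A x) = F x)"

definition operator_commute :: "('a \<Rightarrow> 'a \<Rightarrow> 'a) \<Rightarrow> 'a \<Rightarrow> 'a \<Rightarrow> bool" where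
  "operator_commute p a b \<longleftrightarrow> p a \<circ> p b = p b \<circ> p a"

definition local_minimizer :: "('a::metric_space \<Rightarrow> real) \<Rightarrow> 'a set \<Rightarrow> 'a \<Rightarrow> bool" where
  "local_minimizer f S a \<longleftrightarrow> a \<in> S \<and> (\<exists>r>0. \<forall>x\<in>ball a r \<inter> S. f a \<le> f x)"

(* The vector representing the Frechet derivative at x through the inner product. It is
   unspecified unless f is differentiable at x; in finite dimension it then exists. *)
definition gradient :: "('a::real_inner \<Rightarrow> real) \<Rightarrow> 'a \<Rightarrow> 'a" where
  "gradient f x = (THE g. GDERIV f x :> g)"

lemma gradient_eqI:
  assumes "GDERIV f x :> g"
  shows "gradient f x = g"
  unfolding gradient_def
proof (rule the_equality)
  fix h assume "GDERIV f x :> h"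
  then have "(\<lambda>k. inner k h) = (\<lambda>k. inner k g)"
    using assms unfolding gderiv_def by (rule has_derivative_unique)
  then have "inner (h - g) h = inner (h - g) g"
    by metis
  then have "inner (h - g) (h - g) = 0"
    by (simp add: inner_diff_right)
  then show "h = g"
    by simp
qed (rule assms)

end

theory Submission
  imports Defs
begin

text \<open>
  For all \<open>u\<close> and \<open>v\<close> the commutator \<open>D = [L\<^sub>u, L\<^sub>v]\<close> is a skew-symmetric derivation, so that
  \<open>\<phi>\<^sub>t = exp (t D)\<close> is a one-parameter group of automorphisms. As \<open>\<Omega>\<close> and \<open>F\<close> are
  invariant under \<open>\<phi>\<^sub>t\<close>, the function \<open>t \<mapsto> \<Theta> (\<phi>\<^sub>t a)\<close> has a local minimum at \<open>0\<close>. With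
  \<open>b = \<Theta>'(a)\<close> this gives \<open>0 = \<langle>b, D a\<rangle> = \<langle>[L\<^sub>a, L\<^sub>b] u, v\<rangle>\<close>.
\<close>

section \<open>Finite Parseval frames\<close>

text \<open>Of an orthonormal basis only the expansion identity is kept, as it supplies all the
  coordinates used below. The zero space is covered by the empty frame.\<close>

definition parseval_frame :: "'a::real_inner set \<Rightarrow> bool" where
  "parseval_frame B \<longleftrightarrow> finite B \<and> (\<forall>x. (\<Sum>b\<in>B. inner x b *\<^sub>R b) = x)"

text \<open>Normalizing the nonzero vectors of an orthogonal spanning set gives an orthonormal
  spanning set. The expansion holds on its members by orthonormality and extends to their span by
  linearity.\<close>

lemma parseval_frame_exists:
  assumes "\<exists>B::'a::real_inner set. finite B \<and> span B = UNIV"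
  obtains B :: "'a::real_inner set" where "parseval_frame B"
proof -
  obtain C :: "'a set" where C: "finite C" "span C = UNIV" "pairwise orthogonal C"
    using assms basis_orthogonal by metis
  define B where "B = (\<lambda>c. c /\<^sub>R norm c) ` (C - {0})"
  have B: "finite B"
    using C(1) by (simp add: B_def)
  have orth: "inner b b' = (if b = b' then 1 else 0)" if b: "b \<in> B" and b': "b' \<in> B" for b b'
  proof -
    obtain c c' where c: "c \<in> C" "c \<noteq> 0" "b = c /\<^sub>R norm c"
      and c': "c' \<in> C" "c' \<noteq> 0" "b' = c' /\<^sub>R norm c'"
      using b b' by (auto simp: B_def)
    show ?thesis
    proof (cases "c = c'")
      case True
      then show ?thesis
        using c c' by (simp add: dot_square_norm power2_eq_square)
    next
      case False
      then have "inner c c' = 0"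
        using C(3) c(1) c'(1) by (auto simp: pairwise_def orthogonal_def)
      then have "inner b b' = 0"
        using c c' by simp
      moreover from this have "b \<noteq> b'"
        using c by auto
      ultimately show ?thesis
        by simp
    qed
  qed
  have CB: "C \<subseteq> span B"
  proof
    fix c assume c: "c \<in> C"
    show "c \<in> span B"
    proof (cases "c = 0")
      case False
      then have "c /\<^sub>R norm c \<in> span B"
        using c by (intro span_base) (auto simp: B_def)
      then have "norm c *\<^sub>R (c /\<^sub>R norm c) \<in> span B"
        by (rule span_scale)
      then show ?thesis
        using False by simp
    qed (simp add: span_zero)
  qed
  have spanB: "x \<in> span B" for x
    using span_mono[OF CB] C(2) by (auto simp: span_span)
  have "(\<Sum>b\<in>B. inner x b *\<^sub>R b) = x" for x
    using spanB[of x]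
  proof (induction rule: span_induct_alt)
    case base
    then show ?case by simp
  next
    case (step k c y)
    have "(\<Sum>b\<in>B. inner c b *\<^sub>R b) = (\<Sum>b\<in>B. if c = b then b else 0)"
      using step.hyps orth by (intro sum.cong) auto
    also have "\<dots> = c"
      using step.hyps B by simp
    finally have "(\<Sum>b\<in>B. inner c b *\<^sub>R b) = c" .
    then have "(\<Sum>b\<in>B. (k * inner c b) *\<^sub>R b) = k *\<^sub>R c"
      by (metis (no_types, lifting) scaleR_scaleR scaleR_sum_right sum.cong)
    with step.IH show ?case
      by (simp add: inner_add_left scaleR_add_left sum.distrib)
  qed
  with B that show thesis
    unfolding parseval_frame_def by blast
qed

lemma parseval_frame_inner:
  assumes "parseval_frame B"
  shows "(\<Sum>b\<in>B. inner x b * inner b y) = inner x y"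
proof -
  have "inner (\<Sum>b\<in>B. inner x b *\<^sub>R b) y = inner x y"
    using assms by (simp add: parseval_frame_def)
  then show ?thesis
    by (simp add: inner_sum_left)
qed

lemma linear_parseval_frame:
  assumes "parseval_frame B" "linear f"
  shows "f x = (\<Sum>b\<in>B. inner x b *\<^sub>R f b)"
proof -
  have "f x = f (\<Sum>b\<in>B. inner x b *\<^sub>R b)"
    using assms(1) by (simp add: parseval_frame_def)
  also have "\<dots> = (\<Sum>b\<in>B. inner x b *\<^sub>R f b)"
    using assms(2) by (simp add: linear_sum linear_scale)
  finally show ?thesis .
qed

lemma linear_bounded_parseval_frame:
  fixes f :: "'a::real_inner \<Rightarrow> 'b::real_normed_vector"
  assumes "parseval_frame B" "linear f"
  shows "norm (f x) \<le> norm x * (\<Sum>b\<in>B. norm b * norm (f b))"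
proof -
  have "norm (f x) \<le> (\<Sum>b\<in>B. norm (inner x b *\<^sub>R f b))"
    unfolding linear_parseval_frame[OF assms, of x] by (rule norm_sum)
  also have "\<dots> \<le> (\<Sum>b\<in>B. norm x * norm b * norm (f b))"
    by (intro sum_mono) (simp add: mult_right_mono Cauchy_Schwarz_ineq2)
  finally show ?thesis
    by (simp add: sum_distrib_left mult.assoc)
qed

text \<open>The frame bound for linear maps is applied in each argument in turn. Boundedness is what
  the product rule for derivatives asks of the Jordan product.\<close>

lemma bilinear_imp_bounded_bilinear:
  fixes B :: "'a::real_inner set" and C :: "'b::real_inner set"
    and p :: "'a::real_inner \<Rightarrow> 'b::real_inner \<Rightarrow> 'c::real_normed_vector"
  assumes B: "parseval_frame B" and C: "parseval_frame C" and p: "bilinear p"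
  shows "bounded_bilinear p"
proof
  have l: "linear (\<lambda>x. p x y)" and r: "linear (p x)" for x y
    using p by (simp_all add: bilinear_def)
  define K where "K = (\<Sum>b\<in>B. norm b * (\<Sum>c\<in>C. norm c * norm (p b c)))"
  have "norm (p x y) \<le> norm x * norm y * K" for x y
  proof -
    have "norm (p x y) \<le> norm x * (\<Sum>b\<in>B. norm b * norm (p b y))"
      by (rule linear_bounded_parseval_frame[OF B l])
    also have "\<dots> \<le> norm x * (\<Sum>b\<in>B. norm b * (norm y * (\<Sum>c\<in>C. norm c * norm (p b c))))"
      by (intro mult_left_mono sum_mono linear_bounded_parseval_frame[OF C r]) auto
    also have "\<dots> = norm x * norm y * K"
      by (simp add: K_def sum_distrib_left mult_ac)
    finally show ?thesis .
  qed
  then show "\<exists>K. \<forall>x y. norm (p x y) \<le> norm x * norm y * K"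
    by blast
qed (use p in \<open>simp_all add: bilinear_ladd bilinear_radd bilinear_lmul bilinear_rmul\<close>)

lemma differentiable_imp_GDERIV_gradient:
  fixes B :: "'a::real_inner set" and f :: "'a::real_inner \<Rightarrow> real"
  assumes B: "parseval_frame B" and f: "f differentiable (at x)"
  shows "GDERIV f x :> gradient f x"
proof -
  obtain f' where f': "(f has_derivative f') (at x)"
    using f by (auto simp: differentiable_def)
  \<comment> \<open>This is the Riesz vector of the functional \<open>f'\<close>, built from its
    values on the frame.\<close>
  define g where "g = (\<Sum>b\<in>B. f' b *\<^sub>R b)"
  have "f' h = inner h g" for h
    using linear_parseval_frame[OF B has_derivative_linear[OF f'], of h]
    by (simp add: g_def inner_sum_right mult.commute)
  then have "f' = (\<lambda>h. inner h g)"
    by blast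
  with f' have "GDERIV f x :> g"
    by (simp add: gderiv_def)
  then show ?thesis
    using gradient_eqI by metis
qed

section \<open>The flow of a skew-symmetric operator\<close>

locale skew_operator =
  fixes B :: "'a::real_inner set" and D :: "'a \<Rightarrow> 'a"
  assumes frame: "parseval_frame B"
    and linear_D: "linear D"
    and skew: "inner (D x) y = - inner x (D y)"
begin

definition flow_coeff :: "'a \<Rightarrow> 'a \<Rightarrow> nat \<Rightarrow> real" where
  "flow_coeff x y n = inner ((D ^^ n) x) y / fact n"

text \<open>This is \<open>exp (t D) x\<close>, written coordinate by coordinate so that convergence
  and differentiation reduce to real power series.\<close>

definition flow :: "real \<Rightarrow> 'a \<Rightarrow> 'a" where
  "flow t x = (\<Sum>b\<in>B. (\<Sum>n. flow_coeff x b n * t ^ n) *\<^sub>R b)"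

lemma summable_flow: "summable (\<lambda>n. flow_coeff x y n * t ^ n)"
proof -
  \<comment> \<open>\<open>K\<close> bounds the operator norm of \<open>D\<close>, so the series is
    dominated by a multiple of the exponential series at \<open>K * \<bar>t\<bar>\<close>.\<close>
  define K where "K = (\<Sum>b\<in>B. norm b * norm (D b))"
  have K: "norm (D z) \<le> norm z * K" for z
    unfolding K_def by (rule linear_bounded_parseval_frame[OF frame linear_D])
  have "K \<ge> 0"
    by (simp add: K_def sum_nonneg)
  have pow: "norm ((D ^^ n) x) \<le> norm x * K ^ n" for n
  proof (induction n)
    case (Suc n)
    have "norm ((D ^^ Suc n) x) \<le> norm ((D ^^ n) x) * K"
      using K by simp
    also have "\<dots> \<le> norm x * K ^ n * K"
      using Suc \<open>K \<ge> 0\<close> by (rule mult_right_mono)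
    finally show ?case
      by (simp add: mult_ac)
  qed simp
  have "norm (flow_coeff x y n * t ^ n) \<le> norm x * norm y * ((K * \<bar>t\<bar>) ^ n /\<^sub>R fact n)" for n
  proof -
    have "\<bar>inner ((D ^^ n) x) y\<bar> \<le> norm x * K ^ n * norm y"
      by (rule order.trans[OF Cauchy_Schwarz_ineq2]) (simp add: mult_right_mono pow)
    then have "\<bar>inner ((D ^^ n) x) y\<bar> * (\<bar>t\<bar> ^ n / fact n) \<le> norm x * K ^ n * norm y * (\<bar>t\<bar> ^ n / fact n)"
      by (rule mult_right_mono) simp
    then show ?thesis
      by (simp add: flow_coeff_def abs_mult power_abs power_mult_distrib field_simps)
  qed
  moreover have "summable (\<lambda>n. norm x * norm y * ((K * \<bar>t\<bar>) ^ n /\<^sub>R fact n))"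
    by (intro summable_mult summable_exp_generic)
  ultimately show ?thesis
    by (rule summable_comparison_test'[rotated])
qed

text \<open>The coordinate formula passes from frame members to every \<open>y\<close> by Parseval's
  identity in each coefficient. Identities for the flow can then be checked coefficientwise, without
  the frame.\<close>

lemma inner_flow: "inner (flow t x) y = (\<Sum>n. flow_coeff x y n * t ^ n)"
proof -
  have "(\<lambda>n. \<Sum>b\<in>B. flow_coeff x b n * t ^ n * inner b y) sums
      (\<Sum>b\<in>B. (\<Sum>n. flow_coeff x b n * t ^ n) * inner b y)"
    by (intro sums_sum sums_mult2 summable_sums summable_flow)
  moreover have "(\<Sum>b\<in>B. flow_coeff x b n * t ^ n * inner b y) = flow_coeff x y n * t ^ n" for n
  proof -
    have "(\<Sum>b\<in>B. flow_coeff x b n * t ^ n * inner b y)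
        = (\<Sum>b\<in>B. inner ((D ^^ n) x) b * inner b y) * (t ^ n / fact n)"
      unfolding sum_distrib_right by (intro sum.cong) (simp_all add: flow_coeff_def)
    then show ?thesis
      by (simp add: parseval_frame_inner[OF frame] flow_coeff_def)
  qed
  ultimately show ?thesis
    by (simp add: flow_def inner_sum_left sums_iff)
qed

text \<open>In each coefficient skewness moves \<open>D\<close> to the second argument of the inner
  product; after summation it moves \<open>D\<close> back, and the two signs cancel.\<close>

lemma flow_D: "flow t (D x) = D (flow t x)"
proof -
  have "inner (flow t (D x)) y = inner (D (flow t x)) y" for y
  proof -
    have "flow_coeff (D x) y n = - flow_coeff x (D y) n" for n
      by (simp add: flow_coeff_def skew funpow_swap1[symmetric])
    then have "inner (flow t (D x)) y = - inner (flow t x) (D y)"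
      by (simp add: inner_flow suminf_minus summable_flow)
    then show ?thesis
      by (simp add: skew)
  qed
  then show ?thesis
    by (metis vector_eq_rdot)
qed

lemma flow_0: "flow 0 x = x"
proof -
  have "inner (flow 0 x) y = inner x y" for y
    by (simp add: inner_flow powser_zero) (simp add: flow_coeff_def)
  then show ?thesis
    by (metis vector_eq_rdot)
qed

lemma flow_has_vector_derivative:
  "((\<lambda>t. flow t x) has_vector_derivative D (flow t x)) (at t)"
proof -
  have "((\<lambda>t. \<Sum>n. flow_coeff x b n * t ^ n) has_real_derivative
      (\<Sum>n. flow_coeff (D x) b n * t ^ n)) (at t)" for b
  proof -
    \<comment> \<open>The factor \<open>Suc n\<close> from termwise differentiation turns
      \<open>fact (Suc n)\<close> into \<open>fact n\<close>, leaving one extra application of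
      \<open>D\<close>.\<close>
    have "diffs (flow_coeff x b) = flow_coeff (D x) b"
      by (rule ext) (simp add: diffs_def flow_coeff_def funpow_swap1 del: of_nat_Suc)
    then show ?thesis
      using termdiffs_strong_converges_everywhere[OF summable_flow, of x b t] by simp
  qed
  then have "((\<lambda>t. flow t x) has_vector_derivative flow t (D x)) (at t)"
    unfolding flow_def
    by (intro has_vector_derivative_sum)
      (auto intro!: derivative_eq_intros simp: has_real_derivative_iff_has_vector_derivative)
  then show ?thesis
    by (simp add: flow_D)
qed

text \<open>By skew symmetry, solutions of \<open>z' = D z\<close> have constant norm.\<close>

lemma skew_ode_zero:
  assumes z: "\<And>t. (z has_vector_derivative D (z t)) (at t)" and "z 0 = 0"
  shows "z t = 0"
proof -
  have skew0: "inner (D x) x = 0" for x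
    using skew[of x x] by (simp add: inner_commute)
  have "((\<lambda>t. inner (z t) (z t)) has_real_derivative 0) (at t)" for t
  proof -
    have "((\<lambda>t. inner (z t) (z t)) has_vector_derivative
        inner (z t) (D (z t)) + inner (D (z t)) (z t)) (at t)"
      by (rule bounded_bilinear.has_vector_derivative[OF bounded_bilinear_inner z z])
    then show ?thesis
      by (simp add: skew0 inner_commute[of _ "D _"] has_real_derivative_iff_has_vector_derivative)
  qed
  then have "inner (z t) (z t) = inner (z 0) (z 0)"
    using DERIV_isconst_all by blast
  then show ?thesis
    using assms(2) by simp
qed

text \<open>The difference of two solutions with the same initial value solves the equation and
  vanishes at 0. The algebraic laws of the flow then follow by checking that both sides solve
  \<open>z' = D z\<close>.\<close>

lemma flow_unique:
  assumes z: "\<And>t. (z has_vector_derivative D (z t)) (at t)"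
  shows "z t = flow t (z 0)"
proof -
  have "z t - flow t (z 0) = 0"
  proof (rule skew_ode_zero[of "\<lambda>t. z t - flow t (z 0)"])
    show "((\<lambda>t. z t - flow t (z 0)) has_vector_derivative D (z s - flow s (z 0))) (at s)" for s
      unfolding linear_diff[OF linear_D]
      by (intro has_vector_derivative_diff z flow_has_vector_derivative)
  qed (simp add: flow_0)
  then show ?thesis
    by simp
qed

section \<open>The flow as a one-parameter group of automorphisms\<close>

lemma linear_flow: "linear (flow t)"
proof (rule linearI)
  fix x y
  have "flow t x + flow t y = flow t (flow 0 x + flow 0 y)"
    by (rule flow_unique[of "\<lambda>t. flow t x + flow t y"], unfold linear_add[OF linear_D])
      (intro has_vector_derivative_add flow_has_vector_derivative)
  then show "flow t (x + y) = flow t x + flow t y"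
    by (simp add: flow_0)
next
  fix c x
  have "c *\<^sub>R flow t x = flow t (c *\<^sub>R flow 0 x)"
    by (rule flow_unique[of "\<lambda>t. c *\<^sub>R flow t x"], unfold linear_scale[OF linear_D])
      (intro bounded_linear.has_vector_derivative[OF bounded_linear_scaleR_right]
        flow_has_vector_derivative)
  then show "flow t (c *\<^sub>R x) = c *\<^sub>R flow t x"
    by (simp add: flow_0)
qed

lemma flow_flow: "flow s (flow t x) = flow (s + t) x"
proof -
  have "flow (s + t) x = flow s (flow (0 + t) x)"
  proof (rule flow_unique[of "\<lambda>s. flow (s + t) x"])
    fix s
    have "(((\<lambda>t. flow t x) \<circ> (\<lambda>s. s + t)) has_vector_derivative 1 *\<^sub>R D (flow (s + t) x)) (at s)"
      by (rule vector_diff_chain_at)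
        (auto intro!: derivative_eq_intros flow_has_vector_derivative)
    then show "((\<lambda>s. flow (s + t) x) has_vector_derivative D (flow (s + t) x)) (at s)"
      by (simp add: o_def)
  qed
  then show ?thesis
    by simp
qed

lemma bij_flow: "bij (flow t)"
  by (rule o_bij[of "flow (- t)"]) (auto simp: fun_eq_iff flow_flow flow_0)

text \<open>By the product rule and the Leibniz rule for \<open>D\<close>, the product of two
  trajectories again solves \<open>z' = D z\<close>.\<close>

lemma flow_multiplicative:
  assumes p: "bilinear p" and deriv: "\<forall>x y. D (p x y) = p (D x) y + p x (D y)"
  shows "flow t (p x y) = p (flow t x) (flow t y)"
proof -
  have bb: "bounded_bilinear p"
    by (rule bilinear_imp_bounded_bilinear[OF frame frame p])
  have "p (flow t x) (flow t y) = flow t (p (flow 0 x) (flow 0 y))"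
  proof (rule flow_unique[of "\<lambda>t. p (flow t x) (flow t y)"])
    fix s
    have "((\<lambda>t. p (flow t x) (flow t y)) has_vector_derivative
        p (flow s x) (D (flow s y)) + p (D (flow s x)) (flow s y)) (at s)"
      by (intro bounded_bilinear.has_vector_derivative[OF bb] flow_has_vector_derivative)
    then show "((\<lambda>t. p (flow t x) (flow t y)) has_vector_derivative
        D (p (flow s x) (flow s y))) (at s)"
      by (simp add: deriv add.commute)
  qed
  then show ?thesis
    by (simp add: flow_0)
qed

lemma flow_jordan_Aut:
  assumes "bilinear p" and "\<forall>x y. D (p x y) = p (D x) y + p x (D y)"
  shows "flow t \<in> jordan_Aut p"
  unfolding jordan_Aut_def
  by (intro CollectI conjI allI linear_flow bij_flow flow_multiplicative[OF assms])

text \<open>The orbit of \<open>a\<close> stays in \<open>\<Omega>\<close> and \<open>F\<close> is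
  constant on it, so local minimality concerns \<open>\<Theta>\<close> alone. By the chain rule the
  derivative of \<open>\<Theta>\<close> along the orbit at time 0 is
  \<open>inner (D a) g\<close>.\<close>

lemma local_min_along_flow:
  assumes p: "bilinear p" and deriv: "\<forall>x y. D (p x y) = p (D x) y + p x (D y)"
    and \<Omega>: "weakly_spectral_set p \<Omega>" and F: "weakly_spectral_fun p F"
    and g: "GDERIV \<Theta> a :> g" and min: "local_minimizer (\<lambda>x. \<Theta> x + F x) \<Omega> a"
  shows "inner (D a) g = 0"
proof -
  obtain r where a: "a \<in> \<Omega>" and "r > 0"
    and r: "\<And>x. x \<in> ball a r \<Longrightarrow> x \<in> \<Omega> \<Longrightarrow> \<Theta> a + F a \<le> \<Theta> x + F x"
    using min unfolding local_minimizer_def by blast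
  \<comment> \<open>Continuity keeps the orbit inside the ball of minimality for small times of
    either sign.\<close>
  have "isCont (\<lambda>t. flow t a) 0"
    using flow_has_vector_derivative by (rule has_vector_derivative_continuous)
  then obtain d where "d > 0" and d: "\<And>t. dist t 0 < d \<Longrightarrow> dist (flow t a) (flow 0 a) < r"
    using \<open>r > 0\<close> unfolding continuous_at_eps_delta by metis
  have "((\<lambda>t. \<Theta> (flow t a)) has_real_derivative inner (D a) g) (at 0)"
  proof -
    have "((\<lambda>t. flow t a) has_derivative (\<lambda>t. t *\<^sub>R D a)) (at 0)"
      using flow_has_vector_derivative[of a 0] by (simp add: has_vector_derivative_def flow_0)
    moreover have "(\<Theta> has_derivative (\<lambda>h. inner h g)) (at (flow 0 a))"
      using g by (simp add: gderiv_def flow_0)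
    ultimately have "((\<lambda>t. \<Theta> (flow t a)) has_derivative (\<lambda>t. inner (t *\<^sub>R D a) g)) (at 0)"
      by (rule has_derivative_compose)
    then show ?thesis
      by (simp add: has_field_derivative_def mult_commute_abs)
  qed
  moreover have "\<Theta> (flow 0 a) \<le> \<Theta> (flow t a)" if "\<bar>0 - t\<bar> < d" for t
  proof -
    have A: "flow t \<in> jordan_Aut p"
      by (rule flow_jordan_Aut[OF p deriv])
    have "flow t a \<in> ball a r"
      using d[of t] that by (simp add: flow_0 dist_commute)
    moreover have "flow t a \<in> \<Omega>"
      using \<Omega> A a by (auto simp: weakly_spectral_set_def)
    moreover have "F (flow t a) = F a"
      using F A by (simp add: weakly_spectral_fun_def)
    ultimately show ?thesis
      using r[of "flow t a"] by (simp add: flow_0)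
  qed
  ultimately show ?thesis
    using \<open>d > 0\<close> DERIV_local_min by blast
qed

end

section \<open>Inner derivations\<close>

context euclidean_jordan_algebra
begin

lemmas jprod_add_left = bilinear_ladd[OF bilinear]
lemmas jprod_add_right = bilinear_radd[OF bilinear]
lemmas jprod_diff_left = bilinear_lsub[OF bilinear]
lemmas jprod_diff_right = bilinear_rsub[OF bilinear]

text \<open>The Jordan identity is cubic in \<open>x\<close>. Inclusion-exclusion over the sums of
  \<open>x\<close>, \<open>y\<close>, \<open>z\<close> isolates its part that is linear in each of
  them, which is twice the stated identity.\<close>

lemma jordan_identity_polarized:
  "x \<odot> ((y \<odot> z) \<odot> w) + y \<odot> ((z \<odot> x) \<odot> w) + z \<odot> ((x \<odot> y) \<odot> w)
    = (y \<odot> z) \<odot> (x \<odot> w) + (z \<odot> x) \<odot> (y \<odot> w) + (x \<odot> y) \<odot> (z \<odot> w)"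
  (is "?l = ?r")
proof -
  \<comment> \<open>Pairing with a fixed \<open>v\<close> turns the vector identities into real
    ones, so that linear arithmetic can combine the seven instances.\<close>
  have "inner ?l v = inner ?r v" for v
  proof -
    note e = jordan_identity[THEN arg_cong[where f = "\<lambda>u. inner u v"]]
    note d = jprod_add_left jprod_add_right inner_add_left
      commute[of y x] commute[of z x] commute[of z y]
    show ?thesis
      using e[of "x + y + z" w, unfolded d] e[of "x + y" w, unfolded d]
        e[of "x + z" w, unfolded d] e[of "y + z" w, unfolded d]
        e[of x w] e[of y w] e[of z w]
      unfolding d by linarith
  qed
  then show ?thesis
    by (metis vector_eq_rdot)
qed

definition inner_derivation :: "'a \<Rightarrow> 'a \<Rightarrow> 'a \<Rightarrow> 'a" where
  "inner_derivation u v x = u \<odot> (v \<odot> x) - v \<odot> (u \<odot> x)"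

lemma linear_inner_derivation: "linear (inner_derivation u v)"
  by (rule linearI)
    (simp_all add: inner_derivation_def jprod_add_right bilinear_rmul[OF bilinear]
      scaleR_diff_right)

text \<open>Multiplication operators are self-adjoint, and a commutator of self-adjoint operators is
  skew.\<close>

lemma inner_derivation_skew: "inner (inner_derivation u v x) y = - inner x (inner_derivation u v y)"
  by (simp add: inner_derivation_def inner_diff_left inner_diff_right inner_assoc)

text \<open>The right-hand side of the polarized Jordan identity is symmetric in all four variables;
  exchanging \<open>u\<close> and \<open>v\<close> on the left-hand side gives the Leibniz rule.\<close>

lemma inner_derivation_derivation:
  "inner_derivation u v (x \<odot> y) = inner_derivation u v x \<odot> y + x \<odot> inner_derivation u v y"
proof -
  have "u \<odot> ((x \<odot> y) \<odot> v) + x \<odot> ((y \<odot> u) \<odot> v) + y \<odot> ((u \<odot> x) \<odot> v)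
      = v \<odot> ((x \<odot> y) \<odot> u) + x \<odot> ((y \<odot> v) \<odot> u) + y \<odot> ((v \<odot> x) \<odot> u)"
    unfolding jordan_identity_polarized by (simp add: commute add_ac)
  then have "u \<odot> (v \<odot> (x \<odot> y)) + x \<odot> (v \<odot> (u \<odot> y)) + y \<odot> (v \<odot> (u \<odot> x))
      = v \<odot> (u \<odot> (x \<odot> y)) + x \<odot> (u \<odot> (v \<odot> y)) + y \<odot> (u \<odot> (v \<odot> x))"
    by (metis commute)
  then show ?thesis
    unfolding inner_derivation_def commute[of _ y] jprod_diff_left jprod_diff_right
    by (simp add: algebra_simps commute)
qed

text \<open>Commutativity and self-adjointness let the pairs \<open>u\<close>, \<open>v\<close> and
  \<open>a\<close>, \<open>b\<close> exchange roles: a statement about all inner derivations at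
  \<open>a\<close> becomes one about the commutator of the multiplications by \<open>a\<close> and
  \<open>b\<close>.\<close>

lemma inner_inner_derivation:
  "inner (inner_derivation u v a) b = inner (a \<odot> (b \<odot> u) - b \<odot> (a \<odot> u)) v"
proof -
  have "inner (u \<odot> (v \<odot> a)) b = inner (a \<odot> (b \<odot> u)) v"
    by (metis commute inner_assoc)
  moreover have "inner (v \<odot> (u \<odot> a)) b = inner (b \<odot> (a \<odot> u)) v"
    by (metis commute inner_assoc)
  ultimately show ?thesis
    by (simp add: inner_derivation_def inner_diff_left)
qed

end

section \<open>Operator commutation at a local minimizer\<close>

theorem theorem2:
  fixes jprod :: "'a::real_inner \<Rightarrow> 'a \<Rightarrow> 'a" and e :: 'a
    and \<Omega> :: "'a set" and F \<Theta> :: "'a \<Rightarrow> real" and a :: 'a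
  assumes "euclidean_jordan_algebra jprod e"
    and "weakly_spectral_set jprod \<Omega>"
    and "weakly_spectral_fun jprod F"
    and "\<forall>x. \<Theta> differentiable (at x)"
    and "local_minimizer (\<lambda>x. \<Theta> x + F x) \<Omega> a"
  shows "operator_commute jprod a (gradient \<Theta> a)"
proof -
  interpret euclidean_jordan_algebra jprod e
    by (rule assms(1))
  obtain B :: "'a set" where B: "parseval_frame B"
    using parseval_frame_exists[OF finite_dim] .
  define b where "b = gradient \<Theta> a"
  have b: "GDERIV \<Theta> a :> b"
    unfolding b_def using B assms(4) by (blast intro: differentiable_imp_GDERIV_gradient)
  have "inner (inner_derivation u v a) b = 0" for u v
  proof -
    interpret skew_operator B "inner_derivation u v"
      by (rule skew_operator.intro) (rule B linear_inner_derivation inner_derivation_skew)+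
    show ?thesis
      using bilinear inner_derivation_derivation assms(2,3) b assms(5)
      by (intro local_min_along_flow allI)
  qed
  then have "inner (jprod a (jprod b u) - jprod b (jprod a u)) v = 0" for u v
    by (simp add: inner_inner_derivation)
  \<comment> \<open>As \<open>v\<close> is arbitrary, it may be taken to be the difference of the
    two sides, whose squared norm is then zero.\<close>
  then have "jprod a (jprod b u) = jprod b (jprod a u)" for u
    by (metis inner_eq_zero_iff right_minus_eq)
  then show ?thesis
    by (simp add: operator_commute_def b_def fun_eq_iff)
qed

end
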